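(* Let $N\ge 1$ be an integer and let $f:[0,+\infty)\to\mathbb{R}$ be locally Lipschitz-continuous, with $f\ge 0$ on $[0,+\infty)$ and $$\liminf_{s\to z^+}\frac{f(s)}{s-z}>0\quad\text{for all }z\in[0,+\infty)\text{ such that }f(z)=0.$$ Let $u$ be a bounded nonnegative solution of $$\Delta u+f(u)=0\quad\text{in }\mathbb{R}^N.$$ Then $u$ is constant.
   Context: Solutions are classical, i.e. $u\in C^2(\mathbb{R}^N)$. *)

theory Defs
  imports "HOL-Analysis.Analysis"
begin

(* The library notion is for families of functions indexed by a (time) parameter;
   a single function is the constant family over a one-point parameter set. *)
definition locally_lipschitz_on :: "real set \<Rightarrow> (real \<Rightarrow> real) \<Rightarrow> bool" where
  "locally_lipschitz_on S f \<longleftrightarrow> local_lipschitz {0::real} S (\<lambda>_. f)"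

definition has_partial_deriv :: "'n::finite \<Rightarrow> (real^'n \<Rightarrow> real) \<Rightarrow> real^'n \<Rightarrow> bool" where
  "has_partial_deriv i u x \<longleftrightarrow> (\<lambda>t. u (x + t *\<^sub>R axis i 1)) field_differentiable (at 0)"

(* Meaningful only where has_partial_deriv holds, since deriv is total. *)
definition partial_deriv :: "'n::finite \<Rightarrow> (real^'n \<Rightarrow> real) \<Rightarrow> real^'n \<Rightarrow> real" where
  "partial_deriv i u x = deriv (\<lambda>t. u (x + t *\<^sub>R axis i 1)) 0"

definition C1 :: "(real^'n::finite \<Rightarrow> real) \<Rightarrow> bool" where
  "C1 u \<longleftrightarrow> continuous_on UNIV u \<and>
     (\<forall>i. (\<forall>x. has_partial_deriv i u x) \<and> continuous_on UNIV (partial_deriv i u))"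

definition C2 :: "(real^'n::finite \<Rightarrow> real) \<Rightarrow> bool" where
  "C2 u \<longleftrightarrow> C1 u \<and> (\<forall>i. C1 (partial_deriv i u))"

definition laplacian :: "(real^'n::finite \<Rightarrow> real) \<Rightarrow> real^'n \<Rightarrow> real" where
  "laplacian u x = (\<Sum>i\<in>UNIV. partial_deriv i (partial_deriv i u) x)"

end

(* Put m = inf u and w = u - m. The hypotheses give c, d > 0 with f s >= c (s - m) for
   m < s < m + d. As w is nonnegative and superharmonic, it is identically zero or positive
   everywhere. In the second case choose R so large that phi x = (R^2 - |x - a|^2)^2 satisfies
   Delta phi + c phi > 0 in the ball of radius R about a, and raise t phi from below until it
   touches w. At a touching point where w < d one has t Delta phi <= Delta w <= - c w = - c t phi,
   which is impossible; hence w >= d at the touching point and therefore at the centre a.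
   As a is arbitrary, inf w >= d, which contradicts inf w = 0. *)
theory Submission
  imports Defs
begin

section \<open>Second-order conditions at a touching point\<close>

text \<open>If \<open>l\<close> were negative, \<open>h'\<close> would vanish at 0 and be negative
  just to the right of it, so the mean value theorem would give \<open>h t < h 0\<close> for some
  small positive \<open>t\<close>.\<close>

lemma second_derivative_nonneg_at_local_min:
  fixes h h' :: "real \<Rightarrow> real"
  assumes h: "\<And>t. (h has_real_derivative h' t) (at t)"
    and h': "(h' has_real_derivative l) (at 0)"
    and e: "e > 0" and min: "\<And>t. \<bar>t\<bar> < e \<Longrightarrow> h 0 \<le> h t"
  shows "l \<ge> 0"
proof (rule ccontr)
  assume "\<not> l \<ge> 0"
  then have "l < 0" by simp
  have h0: "h' 0 = 0"
    by (rule DERIV_local_min[OF h e]) (simp add: min)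
  obtain d where d: "d > 0" "\<And>t. 0 < t \<Longrightarrow> t < d \<Longrightarrow> h' t < h' 0"
    using DERIV_neg_dec_right[OF h' \<open>l < 0\<close>] by auto
  define t where "t = min d e / 2"
  have t: "0 < t" "t < d" "t < e"
    using d(1) e by (auto simp: t_def min_def)
  obtain z where z: "0 < z" "z < t" "h t - h 0 = (t - 0) * h' z"
    using MVT2[OF t(1), of h h'] h by blast
  have "h' z < 0" using d(2)[of z] z(1,2) t h0 by simp
  then have "h t < h 0" using z(3) t(1) by (simp add: mult_pos_neg algebra_simps)
  then show False using min[of t] t by simp
qed

text \<open>The definition only differentiates at parameter 0; moving the base point along the axis
  covers every \<open>t\<close>, so that one-variable calculus applies to \<open>u\<close> on a
  coordinate line.\<close>

lemma partial_deriv_along_line: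
  assumes "C1 u"
  shows "((\<lambda>t. u (x + t *\<^sub>R axis i 1)) has_real_derivative
           partial_deriv i u (x + t *\<^sub>R axis i 1)) (at t)"
proof -
  have "(\<lambda>s. u ((x + t *\<^sub>R axis i 1) + s *\<^sub>R axis i 1)) field_differentiable (at 0)"
    using assms by (simp add: C1_def has_partial_deriv_def)
  then have "((\<lambda>s. u ((x + t *\<^sub>R axis i 1) + s *\<^sub>R axis i 1)) has_real_derivative
      partial_deriv i u (x + t *\<^sub>R axis i 1)) (at 0)"
    by (simp add: partial_deriv_def DERIV_deriv_iff_field_differentiable)
  then have "((\<lambda>s. u (x + (s + t) *\<^sub>R axis i 1)) has_real_derivative
      partial_deriv i u (x + t *\<^sub>R axis i 1)) (at 0)"
    by (simp add: scaleR_left_distrib add.assoc add.commute add.left_commute)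
  then show ?thesis
    using DERIV_shift[of "\<lambda>t. u (x + t *\<^sub>R axis i 1)" _ 0 t] by simp
qed

text \<open>The left-hand side of the conclusion is the Laplacian of \<open>y \<mapsto> G (\<bar>y - a\<bar>\<^sup>2)\<close> at \<open>x\<close>.\<close>

lemma laplacian_ge_radial_touching_below:
  fixes u :: "real^'n::finite \<Rightarrow> real"
  assumes "C2 u"
    and G: "\<And>s. (G has_real_derivative G' s) (at s)"
    and G': "\<And>s. (G' has_real_derivative G'' s) (at s)"
    and "e > 0"
    and min: "\<And>y. y \<in> ball x e \<Longrightarrow>
        u x - G ((norm (x - a))\<^sup>2) \<le> u y - G ((norm (y - a))\<^sup>2)"
  shows "4 * G'' ((norm (x - a))\<^sup>2) * (norm (x - a))\<^sup>2
           + 2 * real CARD('n) * G' ((norm (x - a))\<^sup>2) \<le> laplacian u x"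
proof -
  define S where "S = (norm (x - a))\<^sup>2"
  have norm_line: "(norm (x + t *\<^sub>R axis i 1 - a))\<^sup>2 = S + 2 * t * (x - a) $ i + t\<^sup>2"
    for t :: real and i :: 'n
  proof -
    have line: "x + t *\<^sub>R axis i 1 - a = (x - a) + t *\<^sub>R axis i 1" by simp
    show ?thesis
      unfolding S_def power2_norm_eq_inner line
      by (simp del: vector_minus_component add: inner_add_left inner_add_right inner_axis inner_axis' inner_axis_axis
          power2_eq_square inner_commute)
  qed
  \<comment> \<open>On the line in direction \<open>i\<close> the squared distance to
    \<open>a\<close> is the quadratic \<open>q\<close>, and \<open>u\<close> minus \<open>G\<close>
    of \<open>q\<close> has a local minimum at 0. The second-derivative test gives one summand of
    the Laplacian.\<close>
  have part: "4 * G'' S * ((x - a) $ i)\<^sup>2 + 2 * G' S \<le> partial_deriv i (partial_deriv i u) x" for i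
  proof -
    define b where "b = (x - a) $ i"
    define q where "q t = S + 2 * t * b + t\<^sup>2" for t :: real
    have q: "(q has_real_derivative 2 * b + 2 * t) (at t)" for t
      unfolding q_def by (auto intro!: derivative_eq_intros)
    have "((\<lambda>t. G (q t)) has_real_derivative G' (q t) * (2 * b + 2 * t)) (at t)" for t
      by (rule DERIV_chain2[OF G q])
    then have D1: "((\<lambda>t. u (x + t *\<^sub>R axis i 1) - G (q t)) has_real_derivative
        partial_deriv i u (x + t *\<^sub>R axis i 1) - G' (q t) * (2 * b + 2 * t)) (at t)" for t
      using \<open>C2 u\<close> by (intro DERIV_diff partial_deriv_along_line) (auto simp: C2_def)
    have "((\<lambda>t. G' (q t)) has_real_derivative G'' (q 0) * (2 * b + 2 * 0)) (at 0)"
      by (rule DERIV_chain2[OF G' q])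
    then have "((\<lambda>t. G' (q t) * (2 * b + 2 * t)) has_real_derivative
        4 * G'' S * b\<^sup>2 + 2 * G' S) (at 0)"
      by (auto intro!: derivative_eq_intros simp: q_def power2_eq_square)
    moreover have "((\<lambda>t. partial_deriv i u (x + t *\<^sub>R axis i 1)) has_real_derivative
        partial_deriv i (partial_deriv i u) x) (at 0)"
      using partial_deriv_along_line[of "partial_deriv i u" x i 0] \<open>C2 u\<close> by (simp add: C2_def)
    ultimately have D2: "((\<lambda>t. partial_deriv i u (x + t *\<^sub>R axis i 1) - G' (q t) * (2 * b + 2 * t))
        has_real_derivative partial_deriv i (partial_deriv i u) x - (4 * G'' S * b\<^sup>2 + 2 * G' S))
        (at 0)"
      by (intro DERIV_diff)
    have "0 \<le> partial_deriv i (partial_deriv i u) x - (4 * G'' S * b\<^sup>2 + 2 * G' S)"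
    proof (rule second_derivative_nonneg_at_local_min[OF D1 D2 \<open>e > 0\<close>])
      fix t :: real
      assume "\<bar>t\<bar> < e"
      then have "x + t *\<^sub>R axis i 1 \<in> ball x e" by (simp add: dist_norm)
      from min[OF this]
      show "u (x + 0 *\<^sub>R axis i 1) - G (q 0) \<le> u (x + t *\<^sub>R axis i 1) - G (q t)"
        by (simp add: norm_line q_def b_def S_def)
    qed
    then show ?thesis by (simp add: b_def)
  qed
  have "(\<Sum>i\<in>UNIV. ((x - a) $ i)\<^sup>2) = S"
    unfolding S_def power2_norm_eq_inner inner_vec_def by (simp add: power2_eq_square)
  then have "4 * G'' S * S + 2 * real CARD('n) * G' S
      = (\<Sum>i\<in>UNIV. 4 * G'' S * ((x - a) $ i)\<^sup>2 + 2 * G' S)"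
    by (simp add: sum.distrib flip: sum_distrib_left)
  also have "\<dots> \<le> laplacian u x"
    unfolding laplacian_def by (intro sum_mono part)
  finally show ?thesis by (simp add: S_def)
qed

lemma C2_continuous_on: "C2 u \<Longrightarrow> continuous_on A u"
  unfolding C2_def C1_def using continuous_on_subset by blast

section \<open>Strong minimum principle\<close>

text \<open>Comparison with a Gaussian barrier centred at \<open>y\<close>: it vanishes on a sphere
  enclosing \<open>z\<close>, is positive inside it, and is strictly subharmonic away from a small
  ball on which \<open>u\<close> is well above \<open>m\<close>.\<close>

lemma superharmonic_positive:
  fixes u :: "real^'n::finite \<Rightarrow> real"
  assumes "C2 u" and super: "\<And>x. laplacian u x \<le> 0"
    and ge: "\<And>x. m \<le> u x" and "m < u y"
  shows "m < u z"
proof -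
  have "continuous_on UNIV u" using \<open>C2 u\<close> by (rule C2_continuous_on)
  then have "open (u -` {(m + u y) / 2 <..})"
    by (rule open_vimage[rotated]) simp
  then obtain r where r: "r > 0" "ball y r \<subseteq> u -` {(m + u y) / 2 <..}"
    using \<open>m < u y\<close> unfolding open_contains_ball by (force simp: field_simps)
  define R where "R = max r (norm (z - y)) + 1"
  have R: "r < R" "norm (z - y) < R" "0 < R" using r(1) by (auto simp: R_def)
  \<comment> \<open>At squared distance \<open>s\<close> from \<open>y\<close> the Laplacian of the
    barrier has the sign of \<open>4 * \<alpha> * s - 2 * CARD('n)\<close>. This choice makes it
    positive for all \<open>s\<close> from the square of \<open>r\<close> on.\<close>
  define \<alpha> where "\<alpha> = (real CARD('n) + 1) / r\<^sup>2"
  have \<alpha>: "\<alpha> > 0" "\<alpha> * r\<^sup>2 = real CARD('n) + 1"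
    using r(1) by (auto simp: \<alpha>_def intro!: divide_pos_pos add_nonneg_pos)
  define \<epsilon> where "\<epsilon> = (u y - m) / 2"
  have \<epsilon>: "\<epsilon> > 0" using \<open>m < u y\<close> by (simp add: \<epsilon>_def)
  define G where "G s = \<epsilon> * (exp (- \<alpha> * s) - exp (- \<alpha> * R\<^sup>2))" for s
  define G' where "G' s = - (\<epsilon> * \<alpha> * exp (- \<alpha> * s))" for s
  define G'' where "G'' s = \<epsilon> * \<alpha>\<^sup>2 * exp (- \<alpha> * s)" for s
  have dG: "(G has_real_derivative G' s) (at s)" for s
    unfolding G_def G'_def by (auto intro!: derivative_eq_intros)
  have dG': "(G' has_real_derivative G'' s) (at s)" for s
    unfolding G'_def G''_def by (auto intro!: derivative_eq_intros simp: power2_eq_square)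
  define v where "v x = u x - G ((norm (x - y))\<^sup>2)" for x
  have "continuous_on (cball y R) v"
    unfolding v_def G_def by (intro continuous_intros C2_continuous_on[OF \<open>C2 u\<close>])
  then obtain x where x: "x \<in> cball y R" "\<And>x'. x' \<in> cball y R \<Longrightarrow> v x \<le> v x'"
    using continuous_attains_inf[of "cball y R" v] R by auto
  \<comment> \<open>In the small ball \<open>u\<close> exceeds \<open>m + \<epsilon>\<close> while
    the barrier is at most \<open>\<epsilon>\<close>; on the outer sphere the barrier is zero; in
    between, an interior minimum contradicts superharmonicity.\<close>
  have "m \<le> v x"
  proof (cases "norm (x - y) < r")
    case True
    then have "x \<in> ball y r" by (simp add: dist_norm norm_minus_commute)
    then have "(m + u y) / 2 < u x" using r(2) by blast
    moreover have "exp (- \<alpha> * (norm (x - y))\<^sup>2) \<le> 1" using \<alpha>(1) by simp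
    then have "G ((norm (x - y))\<^sup>2) \<le> \<epsilon>"
      unfolding G_def using \<epsilon> by (simp add: mult_le_cancel_left1 add_increasing2 algebra_simps)
    ultimately show ?thesis by (simp add: v_def \<epsilon>_def field_simps)
  next
    case False
    show ?thesis
    proof (cases "norm (x - y) = R")
      case True
      then show ?thesis using ge[of x] by (simp add: v_def G_def)
    next
      case R': False
      define e where "e = R - norm (x - y)"
      have e: "e > 0" using R' x(1) by (simp add: e_def dist_norm norm_minus_commute)
      have "4 * G'' ((norm (x - y))\<^sup>2) * (norm (x - y))\<^sup>2
           + 2 * real CARD('n) * G' ((norm (x - y))\<^sup>2) \<le> laplacian u x"
      proof (rule laplacian_ge_radial_touching_below[OF \<open>C2 u\<close> dG dG' e])
        fix x'
        assume "x' \<in> ball x e"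
        then have "x' \<in> cball y R"
          using dist_triangle[of y x' x] by (simp add: e_def dist_norm norm_minus_commute)
        from x(2)[OF this]
        show "u x - G ((norm (x - y))\<^sup>2) \<le> u x' - G ((norm (x' - y))\<^sup>2)"
          by (simp add: v_def)
      qed
      moreover have "4 * G'' ((norm (x - y))\<^sup>2) * (norm (x - y))\<^sup>2
           + 2 * real CARD('n) * G' ((norm (x - y))\<^sup>2)
          = \<epsilon> * \<alpha> * exp (- \<alpha> * (norm (x - y))\<^sup>2)
              * (4 * (\<alpha> * (norm (x - y))\<^sup>2) - 2 * real CARD('n))"
        by (simp add: G'_def G''_def power2_eq_square algebra_simps)
      moreover have "\<alpha> * r\<^sup>2 \<le> \<alpha> * (norm (x - y))\<^sup>2"
        using False r(1) \<alpha>(1) by (intro mult_left_mono power_mono) auto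
      then have "0 < 4 * (\<alpha> * (norm (x - y))\<^sup>2) - 2 * real CARD('n)"
        using \<alpha>(2) by linarith
      then have "0 < \<epsilon> * \<alpha> * exp (- \<alpha> * (norm (x - y))\<^sup>2)
              * (4 * (\<alpha> * (norm (x - y))\<^sup>2) - 2 * real CARD('n))"
        using \<epsilon> \<alpha>(1) by simp
      ultimately show ?thesis using super[of x] by linarith
    qed
  qed
  also have "v x \<le> v z" using R by (intro x(2)) (simp add: dist_norm norm_minus_commute)
  finally have "m + G ((norm (z - y))\<^sup>2) \<le> u z" by (simp add: v_def)
  moreover have "(norm (z - y))\<^sup>2 < R\<^sup>2" using R by (intro power_strict_mono) auto
  then have "0 < G ((norm (z - y))\<^sup>2)" using \<alpha>(1) \<epsilon> by (simp add: G_def)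
  ultimately show ?thesis by linarith
qed

section \<open>Uniform lower bound by a sliding bump\<close>

text \<open>The bump is largest at its centre, so \<open>u a < m + d\<close> forces the value at the
  touching point below \<open>m + d\<close> too; there \<open>lap\<close> applies and conflicts with
  the bump being a strict subsolution.\<close>

lemma supersolution_lower_bound:
  fixes u :: "real^'n::finite \<Rightarrow> real"
  assumes "C2 u" and pos: "\<And>x. m < u x" and "c > 0"
    and lap: "\<And>x. u x < m + d \<Longrightarrow> laplacian u x \<le> - c * (u x - m)"
  shows "m + d \<le> u a"
proof (rule ccontr)
  assume "\<not> m + d \<le> u a"
  then have ua: "u a < m + d" by simp
  define N where "N = real CARD('n)"
  have "N \<ge> 0" by (simp add: N_def)
  \<comment> \<open>\<open>K\<close> is the squared radius of the ball, large enough to dominate the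
    square completed at the end of the proof.\<close>
  define K where "K = (4 + 2 * N)\<^sup>2 / c"
  have K: "K > 0" "c * K = (4 + 2 * N)\<^sup>2"
    using \<open>c > 0\<close> \<open>N \<ge> 0\<close> by (auto simp: K_def)
  define \<phi> where "\<phi> x = (K - (norm (x - a))\<^sup>2)\<^sup>2" for x
  define B where "B = cball a (sqrt K)"
  have B_iff: "x \<in> B \<longleftrightarrow> (norm (x - a))\<^sup>2 \<le> K" for x
    unfolding B_def mem_cball dist_norm norm_minus_commute[of a x]
    by (metis abs_norm_cancel real_sqrt_abs real_sqrt_le_iff)
  \<comment> \<open>Maximising this ratio yields the touching point directly: the reciprocal of the
    maximum is the largest \<open>t\<close> with \<open>t * \<phi>\<close> below
    \<open>u - m\<close> on \<open>B\<close>.\<close>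
  have "continuous_on B (\<lambda>x. \<phi> x / (u x - m))"
    unfolding \<phi>_def using pos
    by (intro continuous_intros C2_continuous_on[OF \<open>C2 u\<close>]) (metis less_irrefl eq_iff_diff_eq_0)
  moreover have "compact B" "a \<in> B" using K(1) by (auto simp: B_def)
  ultimately obtain x where x: "x \<in> B"
      "\<And>x'. x' \<in> B \<Longrightarrow> \<phi> x' / (u x' - m) \<le> \<phi> x / (u x - m)"
    using continuous_attains_sup[of B "\<lambda>x. \<phi> x / (u x - m)"] by auto
  have "0 < \<phi> a / (u a - m)" using pos[of a] K(1) by (simp add: \<phi>_def)
  also have "\<dots> \<le> \<phi> x / (u x - m)" by (rule x(2)[OF \<open>a \<in> B\<close>])
  \<comment> \<open>Since \<open>\<phi>\<close> vanishes on the boundary of \<open>B\<close>, the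
    touching point is interior.\<close>
  finally have \<phi>x: "\<phi> x > 0" using pos[of x] by (simp add: zero_less_divide_iff)
  define t where "t = (u x - m) / \<phi> x"
  have t: "t > 0" "t * \<phi> x = u x - m" using \<phi>x pos[of x] by (auto simp: t_def)
  have below: "t * \<phi> x' \<le> u x' - m" if "x' \<in> B" for x'
    using x(2)[OF that] pos[of x'] pos[of x] \<phi>x by (simp add: t_def field_simps)
  define g where "g = K - (norm (x - a))\<^sup>2"
  have g: "g > 0" "g \<le> K" "\<phi> x = g\<^sup>2"
    using x(1) \<phi>x by (auto simp: g_def B_iff \<phi>_def less_le)
  have "u x - m = t * g\<^sup>2" using t g by simp
  also have "\<dots> \<le> t * K\<^sup>2" using t g by (intro mult_left_mono power_mono) auto
  also have "\<dots> \<le> u a - m" using below[OF \<open>a \<in> B\<close>] by (simp add: \<phi>_def)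
  finally have "laplacian u x \<le> - c * (t * g\<^sup>2)"
    using lap[of x] ua t g by simp
  moreover have "4 * (2 * t) * (norm (x - a))\<^sup>2
      + 2 * real CARD('n) * (- 2 * t * (K - (norm (x - a))\<^sup>2)) \<le> laplacian u x"
  proof (rule laplacian_ge_radial_touching_below[OF \<open>C2 u\<close>, where G = "\<lambda>s. t * (K - s)\<^sup>2"])
    show "((\<lambda>s. t * (K - s)\<^sup>2) has_real_derivative - 2 * t * (K - s)) (at s)" for s
      by (auto intro!: derivative_eq_intros simp: algebra_simps)
    show "((\<lambda>s. - 2 * t * (K - s)) has_real_derivative 2 * t) (at s)" for s
      by (auto intro!: derivative_eq_intros)
    have "norm (x - a) < sqrt K" using g(1) by (intro real_less_rsqrt) (simp add: g_def)
    then show "0 < sqrt K - norm (x - a)" by simp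
    fix x'
    assume "x' \<in> ball x (sqrt K - norm (x - a))"
    then have "x' \<in> B"
      using dist_triangle[of a x' x] by (simp add: B_def dist_norm norm_minus_commute)
    from below[OF this] t(2)
    show "u x - t * (K - (norm (x - a))\<^sup>2)\<^sup>2 \<le> u x' - t * (K - (norm (x' - a))\<^sup>2)\<^sup>2"
      by (simp add: \<phi>_def)
  qed
  ultimately have "t * (8 * (K - g) - 4 * N * g + c * g\<^sup>2) \<le> 0"
    by (simp add: g_def N_def algebra_simps)
  then have "8 * (K - g) - 4 * N * g + c * g\<^sup>2 \<le> 0"
    using t(1) by (simp add: mult_le_0_iff)
  then have "c * (8 * (K - g) - 4 * N * g + c * g\<^sup>2) \<le> 0"
    using \<open>c > 0\<close> by (simp add: mult_le_0_iff)
  \<comment> \<open>Completing the square in \<open>c * g\<close>: by the choice of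
    \<open>K\<close>, the remaining constant is seven times the square of
    \<open>4 + 2 * N\<close>.\<close>
  moreover have "c * (8 * (K - g) - 4 * N * g + c * g\<^sup>2)
      = (c * g - (4 + 2 * N))\<^sup>2 + 8 * (c * K) - (4 + 2 * N)\<^sup>2"
    by (simp add: power2_eq_square algebra_simps)
  ultimately have "(c * g - (4 + 2 * N))\<^sup>2 + 7 * (4 + 2 * N)\<^sup>2 \<le> 0"
    using K(2) by simp
  moreover have "(4 + 2 * N)\<^sup>2 > 0" using \<open>N \<ge> 0\<close> by simp
  ultimately show False using zero_le_power2[of "c * g - (4 + 2 * N)"] by linarith
qed

section \<open>Linear growth of the nonlinearity to the right of a point\<close>

text \<open>At a zero of \<open>f\<close> the liminf condition supplies the slope. Elsewhere
  continuity keeps \<open>f\<close> above \<open>f m / 2\<close> near \<open>m\<close>, and the line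
  that climbs from 0 at \<open>m\<close> to \<open>f m / 2\<close> at \<open>m + d\<close> stays
  below it.\<close>

lemma linear_lower_bound_right:
  fixes f :: "real \<Rightarrow> real"
  assumes "locally_lipschitz_on {0..} f"
    and "\<And>s. s \<ge> 0 \<Longrightarrow> f s \<ge> 0"
    and lim: "f m = 0 \<Longrightarrow> Liminf (at_right m) (\<lambda>s. ereal (f s / (s - m))) > 0"
    and "m \<ge> 0"
  obtains c d where "c > 0" "d > 0" "\<And>s. m < s \<Longrightarrow> s < m + d \<Longrightarrow> c * (s - m) \<le> f s"
proof (cases "f m = 0")
  case True
  from lim[OF this] obtain c :: ereal where c: "0 < c"
      "c < Liminf (at_right m) (\<lambda>s. ereal (f s / (s - m)))"
    using dense by blast
  then obtain c' where c': "c = ereal c'" by (cases c) auto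
  have "\<forall>\<^sub>F s in at_right m. c < ereal (f s / (s - m))"
    using c(2) less_LiminfD by blast
  then obtain b where b: "b > m" "\<And>s. m < s \<Longrightarrow> s < b \<Longrightarrow> c' < f s / (s - m)"
    unfolding eventually_at_right_field c' by auto
  show thesis
  proof (rule that[of c' "b - m"])
    show "c' * (s - m) \<le> f s" if "m < s" "s < m + (b - m)" for s
      using b(2)[of s] that by (simp add: pos_less_divide_eq less_imp_le)
  qed (use b c c' in auto)
next
  case False
  then have fm: "f m > 0" using assms(2)[OF \<open>m \<ge> 0\<close>] by simp
  have "continuous_on {0..} f"
    using assms(1) local_lipschitz_continuous_on[of "{0}" "{0..}" "\<lambda>_. f" 0]
    by (simp add: locally_lipschitz_on_def)
  then obtain d where d: "d > 0"
      "\<And>s. s \<in> {0..} \<Longrightarrow> dist s m < d \<Longrightarrow> dist (f s) (f m) < f m / 2"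
    unfolding continuous_on_iff using \<open>m \<ge> 0\<close> fm by (metis atLeast_iff half_gt_zero)
  show thesis
  proof (rule that[of "f m / (2 * d)" d])
    fix s
    assume s: "m < s" "s < m + d"
    have "f m / (2 * d) * (s - m) \<le> f m / (2 * d) * d"
      using s fm d(1) by (intro mult_left_mono) auto
    also have "\<dots> = f m / 2" using d(1) by simp
    also have "\<dots> \<le> f s" using d(2)[of s] s \<open>m \<ge> 0\<close> by (auto simp: dist_real_def abs_if split: if_splits)
    finally show "f m / (2 * d) * (s - m) \<le> f s" .
  qed (use fm d in auto)
qed

section \<open>Constancy of the solution\<close>

theorem theorem2p1:
  fixes f :: "real \<Rightarrow> real" and u :: "real^'n::finite \<Rightarrow> real"
  assumes "locally_lipschitz_on {0..} f"
    and "\<And>s. s \<ge> 0 \<Longrightarrow> f s \<ge> 0"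
    and "\<And>z. z \<ge> 0 \<Longrightarrow> f z = 0 \<Longrightarrow> Liminf (at_right z) (\<lambda>s. ereal (f s / (s - z))) > 0"
    and "C2 u"
    and "bounded (range u)"
    and "\<And>x. u x \<ge> 0"
    and "\<And>x. laplacian u x + f (u x) = 0"
  shows "u constant_on UNIV"
proof -
  define m where "m = (INF x. u x)"
  have "bdd_below (range u)" using assms(6) by (intro bdd_belowI[of _ 0]) auto
  then have le: "m \<le> u x" for x unfolding m_def by (intro cINF_lower) auto
  have "m \<ge> 0" unfolding m_def using assms(6) by (intro cINF_greatest) auto
  have lap: "laplacian u x = - f (u x)" for x using assms(7)[of x] by linarith
  obtain c d where cd: "c > 0" "d > 0" "\<And>s. m < s \<Longrightarrow> s < m + d \<Longrightarrow> c * (s - m) \<le> f s"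
    using linear_lower_bound_right[OF assms(1,2,3) \<open>m \<ge> 0\<close>] \<open>m \<ge> 0\<close> by blast
  have "u y = m" for y
  proof (rule ccontr)
    assume "u y \<noteq> m"
    then have "m < u y" using le[of y] by simp
    \<comment> \<open>Nonnegativity of \<open>f\<close> makes \<open>u\<close> superharmonic, so one
      value above the infimum puts all values above it.\<close>
    then have pos: "m < u x" for x
      using superharmonic_positive[OF assms(4) _ le] lap assms(2,6) by fastforce
    \<comment> \<open>The gap \<open>d\<close> does not depend on \<open>x\<close>, so it passes to
      the infimum.\<close>
    have "m + d \<le> u x" for x
      using supersolution_lower_bound[OF assms(4) pos cd(1), of d] lap cd(3) pos by simp
    then have "m + d \<le> m" unfolding m_def by (intro cINF_greatest) auto
    then show False using cd(2) by simp
  qed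
  then show ?thesis by (auto simp: constant_on_def)
qed

end
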